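(* Let $X$ be a strong PP-space, $Y$ a topological space, $Z$ a perfectly normal space and $0\le\alpha<\omega_1$. Then $$C\overline{H_{\alpha}^*}(X\times Y,Z)\subseteq H_{\alpha+1}^*(X\times Y,Z).$$ That is, if $f:X\times Y\to Z$ is such that $f(\cdot,y):X\to Z$ is continuous for every $y\in Y$ and the set of all $x\in X$ for which $f(x,\cdot)\in H_\alpha^*(Y,Z)$ is dense in $X$, then $f\in H_{\alpha+1}^*(X\times Y,Z)$.
   Context: A zero set (co-zero set) in a space $S$ is a set of the form $g^{-1}(0)$ (respectively $g^{-1}((0,1])$) with $g:S\to[0,1]$ continuous. Functional classes. Let $\mathcal G_0^*$ and $\mathcal F_0^*$ be the collections of all co-zero and all zero subsets of $S$, respectively. For $0<\alpha<\omega_1$: if $\alpha$ is odd, $\mathcal G_\alpha^*$ (resp. $\mathcal F_\alpha^*$) consists of all countable intersections (resp. unions) of sets from the classes $\mathcal G_\xi^*$ (resp. $\mathcal F_\xi^*$) with $\xi<\alpha$; if $\alpha$ is even, $\mathcal G_\alpha^*$ (resp. $\mathcal F_\alpha^*$) consists of all countable unions (resp. intersections) of sets from the classes $\mathcal G_\xi^*$ (resp. $\mathcal F_\xi^*$) with $\xi<\alpha$. (Limit ordinals are even.) The $\alpha$'th functionally additive class is $\mathcal F_\alpha^*$ for odd $\alpha$ and $\mathcal G_\alpha^*$ for even $\alpha$. $H_\alpha^*(S,T)$ (functional $\alpha$-th Lebesgue class) is the set of all mappings $g:S\to T$ such that $g^{-1}(V)$ belongs to the $\alpha$'th functionally additive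 class in $S$ for every open set $V\subseteq T$. A topological space $X$ is a strong PP-space if for every dense set $D\subseteq X$ there exist a sequence $((U_{i,n}:i\in I_n))_{n=1}^\infty$ of locally finite covers of $X$ by co-zero sets $U_{i,n}$ and a sequence $((x_{i,n}:i\in I_n))_{n=1}^\infty$ of families of points of $D$ such that for every $x\in X$ and every sequence of indices $i_n\in I_n$ with $x\in U_{i_n,n}$ for all $n\in\mathbb N$, one has $x_{i_n,n}\to x$. A space is perfectly normal if it is normal and each of its closed subsets is a $G_\delta$-set. *)

theory Defs
  imports "HOL-Analysis.Analysis"
begin

section \<open>Countable ordinals\<close>

text \<open>The ordinals below \<open>\<omega>\<^sub>1\<close>: the field of the least uncountable cardinal, which is a
  well-order. Lemmas \<open>countable_lessThan_omega1\<close> and \<open>uncountable_omega1\<close> characterise the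
  resulting order up to isomorphism.\<close>

typedef omega1 = "Field (cardSuc natLeq)"
proof -
  have "\<not> finite (Field (cardSuc natLeq))"
    using cardSuc_finite[OF natLeq_Card_order] Field_natLeq by simp
  then show ?thesis by (metis ex_in_conv finite.emptyI)
qed

lemma Card_order_omega1: "Card_order (cardSuc natLeq)"
  by (rule cardSuc_Card_order[OF natLeq_Card_order])

lemma Well_order_omega1: "Well_order (cardSuc natLeq)"
  using Card_order_omega1 by (simp add: card_order_on_def)

lemma infinite_omega1: "\<not> finite (Field (cardSuc natLeq))"
  using cardSuc_finite[OF natLeq_Card_order] Field_natLeq by simp

instantiation omega1 :: wellorder
begin

definition less_eq_omega1 :: "omega1 \<Rightarrow> omega1 \<Rightarrow> bool" where
  "\<alpha> \<le> \<beta> \<longleftrightarrow> (Rep_omega1 \<alpha>, Rep_omega1 \<beta>) \<in> cardSuc natLeq"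

definition less_omega1 :: "omega1 \<Rightarrow> omega1 \<Rightarrow> bool" where
  "\<alpha> < \<beta> \<longleftrightarrow> (Rep_omega1 \<alpha>, Rep_omega1 \<beta>) \<in> cardSuc natLeq \<and> \<alpha> \<noteq> \<beta>"

instance
proof -
  let ?r = "cardSuc natLeq"
  have lin: "refl_on (Field ?r) ?r" "trans ?r" "antisym ?r" "total_on (Field ?r) ?r"
    and wf: "wf (?r - Id)"
    using Well_order_omega1
    by (auto simp: well_order_on_def linear_order_on_def partial_order_on_def preorder_on_def)
  have wf': "wf {(\<alpha>::omega1, \<beta>). \<alpha> < \<beta>}"
  proof (rule wf_subset[OF wf_inv_image[OF wf, of Rep_omega1]])
    show "{(\<alpha>, \<beta>). \<alpha> < \<beta>} \<subseteq> inv_image (?r - Id) Rep_omega1"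
      by (auto simp: less_omega1_def inv_image_def Rep_omega1_inject)
  qed
  show "OFCLASS(omega1, wellorder_class)"
  proof
    fix \<alpha> \<beta> \<gamma> :: omega1
    show refl: "\<alpha> \<le> \<alpha>"
      using lin(1) Rep_omega1 by (auto simp: less_eq_omega1_def refl_on_def)
    show trans: "\<alpha> \<le> \<gamma>" if "\<alpha> \<le> \<beta>" "\<beta> \<le> \<gamma>"
      using lin(2) that by (auto simp: less_eq_omega1_def dest: transD)
    show anti: "\<alpha> = \<beta>" if "\<alpha> \<le> \<beta>" "\<beta> \<le> \<alpha>"
      using lin(3) that by (auto simp: less_eq_omega1_def Rep_omega1_inject dest: antisymD)
    show "(\<alpha> < \<beta>) = (\<alpha> \<le> \<beta> \<and> \<not> \<beta> \<le> \<alpha>)"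
      using lin(1,3) Rep_omega1
      by (metis less_eq_omega1_def less_omega1_def Rep_omega1_inject antisymD refl_onD)
    show "\<alpha> \<le> \<beta> \<or> \<beta> \<le> \<alpha>"
      using lin(1,4) Rep_omega1
      by (metis less_eq_omega1_def total_on_def refl_onD Rep_omega1_inject)
    show "P \<alpha>" if "\<And>x. (\<And>y. y < x \<Longrightarrow> P y) \<Longrightarrow> P x" for P
      using wf_induct_rule[OF wf', of P \<alpha>] that by auto
  qed
qed

end

lemma image_Rep_lessThan_omega1:
  "Rep_omega1 ` {..<\<alpha>} = underS (cardSuc natLeq) (Rep_omega1 \<alpha>)"
proof -
  have "x \<in> Rep_omega1 ` {..<\<alpha>}" if "x \<in> underS (cardSuc natLeq) (Rep_omega1 \<alpha>)" for x
  proof -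
    from that have "x \<in> Field (cardSuc natLeq)" by (auto simp: underS_def Field_def)
    then obtain \<beta> where "x = Rep_omega1 \<beta>" by (metis Rep_omega1_cases)
    with that show ?thesis by (auto simp: underS_def less_omega1_def)
  qed
  then show ?thesis
    by (auto simp: underS_def less_omega1_def Rep_omega1_inject)
qed

lemma range_Rep_omega1: "range Rep_omega1 = Field (cardSuc natLeq)"
  using type_definition.Rep_range[OF type_definition_omega1] .

lemma countable_lessThan_omega1: "countable {..<\<alpha>::omega1}"
proof -
  let ?S = "underS (cardSuc natLeq) (Rep_omega1 \<alpha>)"
  have "(card_of ?S, cardSuc natLeq) \<in> ordLess"
    using card_of_underS[OF Card_order_omega1] Rep_omega1 by blast
  then have "(card_of ?S, natLeq) \<in> ordLeq"
    using cardSuc_ordLeq_ordLess[OF natLeq_Card_order card_of_Card_order] by blast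
  then have "(card_of ?S, card_of (UNIV :: nat set)) \<in> ordLeq"
    using card_of_nat ordIso_symmetric ordLeq_ordIso_trans by blast
  then have "countable ?S"
    using card_of_ordLeq[of ?S "UNIV :: nat set"] by (auto simp: countable_def)
  then have "countable (Rep_omega1 ` {..<\<alpha>})"
    by (simp add: image_Rep_lessThan_omega1)
  then show ?thesis
    by (rule countable_image_inj_on) (auto simp: inj_on_def Rep_omega1_inject)
qed

lemma uncountable_omega1: "uncountable (UNIV :: omega1 set)"
proof
  assume "countable (UNIV :: omega1 set)"
  then have "countable (Field (cardSuc natLeq))"
    by (metis range_Rep_omega1 countable_image)
  then have "(card_of (Field (cardSuc natLeq)), card_of (UNIV :: nat set)) \<in> ordLeq"
    using card_of_ordLeq[of "Field (cardSuc natLeq)" "UNIV :: nat set"]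
    by (auto simp: countable_def)
  then have "(cardSuc natLeq, natLeq) \<in> ordLeq"
    using card_of_nat card_of_Field_ordIso[OF Card_order_omega1] ordIso_symmetric
      ordLeq_ordIso_trans ordIso_ordLeq_trans by blast
  then show False
    using cardSuc_greater[OF natLeq_Card_order] not_ordLess_ordLeq by blast
qed

lemma omega1_no_top: "\<exists>\<beta>. (\<alpha>::omega1) < \<beta>"
proof (rule ccontr)
  assume "\<nexists>\<beta>. \<alpha> < \<beta>"
  then have "UNIV = insert \<alpha> {..<\<alpha>}" by (auto simp: not_less order.order_iff_strict)
  then show False
    using uncountable_omega1 countable_lessThan_omega1 by (metis countable_insert)
qed

instantiation omega1 :: zero
begin
definition zero_omega1 :: omega1 where "0 = (LEAST \<alpha>::omega1. True)"
instance ..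
end

lemma omega1_zero_le: "0 \<le> (\<alpha>::omega1)"
  by (simp add: zero_omega1_def Least_le)

definition osuc :: "omega1 \<Rightarrow> omega1" where
  "osuc \<alpha> = (LEAST \<beta>. \<alpha> < \<beta>)"

lemma less_osuc: "\<alpha> < osuc \<alpha>"
  unfolding osuc_def using omega1_no_top by (rule LeastI_ex)

lemma osuc_le_iff: "osuc \<alpha> \<le> \<beta> \<longleftrightarrow> \<alpha> < \<beta>"
  using less_osuc[of \<alpha>] by (auto simp: osuc_def intro: Least_le)

lemma osuc_inject: "osuc \<alpha> = osuc \<beta> \<longleftrightarrow> \<alpha> = \<beta>"
  by (metis less_osuc osuc_le_iff linorder_neqE not_less)

text \<open>Every ordinal is uniquely \<open>\<lambda> + n\<close> with \<open>\<lambda>\<close> zero or a limit and \<open>n\<close> finite; its parity is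
  that of \<open>n\<close>.\<close>

definition even_ord :: "omega1 \<Rightarrow> bool" where
  "even_ord \<alpha> \<longleftrightarrow> (\<exists>l n. (\<forall>\<beta>. l \<noteq> osuc \<beta>) \<and> even n \<and> \<alpha> = (osuc ^^ n) l)"

abbreviation odd_ord :: "omega1 \<Rightarrow> bool" where
  "odd_ord \<alpha> \<equiv> \<not> even_ord \<alpha>"

lemma even_ord_nonsuc: "(\<And>\<beta>. \<alpha> \<noteq> osuc \<beta>) \<Longrightarrow> even_ord \<alpha>"
  unfolding even_ord_def by (metis even_zero funpow_0)

lemma even_ord_zero: "even_ord 0"
  by (metis even_ord_nonsuc less_osuc omega1_zero_le not_less)

lemma omega1_decompose: "\<exists>l n. (\<forall>\<beta>. l \<noteq> osuc \<beta>) \<and> \<alpha> = (osuc ^^ n) l"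
proof (induction \<alpha> rule: less_induct)
  case (less \<alpha>)
  show ?case
  proof (cases "\<exists>\<beta>. \<alpha> = osuc \<beta>")
    case True
    then obtain \<beta> where \<beta>: "\<alpha> = osuc \<beta>" by blast
    with less.IH[of \<beta>] less_osuc obtain l n where "\<forall>\<gamma>. l \<noteq> osuc \<gamma>" "\<beta> = (osuc ^^ n) l"
      by blast
    with \<beta> have "\<alpha> = (osuc ^^ Suc n) l" by simp
    with \<open>\<forall>\<gamma>. l \<noteq> osuc \<gamma>\<close> show ?thesis by blast
  next
    case False
    then show ?thesis by (metis funpow_0)
  qed
qed

lemma omega1_decompose_unique:
  assumes "\<forall>\<beta>. l \<noteq> osuc \<beta>" "\<forall>\<beta>. l' \<noteq> osuc \<beta>" "(osuc ^^ n) l = (osuc ^^ m) l'"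
  shows "l = l' \<and> n = m"
  using assms(3)
proof (induction n arbitrary: m)
  case 0
  then show ?case using assms(1) by (cases m) auto
next
  case (Suc n)
  then show ?case using assms(2) by (cases m) (auto simp: osuc_inject)
qed

lemma even_ord_osuc: "even_ord (osuc \<alpha>) \<longleftrightarrow> odd_ord \<alpha>"
proof -
  obtain l n where l: "\<forall>\<beta>. l \<noteq> osuc \<beta>" and \<alpha>: "\<alpha> = (osuc ^^ n) l"
    using omega1_decompose by blast
  have "osuc \<alpha> = (osuc ^^ Suc n) l" using \<alpha> by simp
  then have "even_ord (osuc \<alpha>) \<longleftrightarrow> even (Suc n)"
    unfolding even_ord_def using omega1_decompose_unique l by metis
  moreover have "even_ord \<alpha> \<longleftrightarrow> even n"
    unfolding even_ord_def using omega1_decompose_unique l \<alpha> by metis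
  ultimately show ?thesis by simp
qed


section \<open>Functional classes\<close>

definition zero_set_in :: "'a topology \<Rightarrow> 'a set \<Rightarrow> bool" where
  "zero_set_in S A \<longleftrightarrow>
     (\<exists>g. continuous_map S (top_of_set {0..1::real}) g \<and> A = {x \<in> topspace S. g x = 0})"

definition cozero_set_in :: "'a topology \<Rightarrow> 'a set \<Rightarrow> bool" where
  "cozero_set_in S A \<longleftrightarrow>
     (\<exists>g. continuous_map S (top_of_set {0..1::real}) g \<and> A = {x \<in> topspace S. g x \<in> {0<..1}})"

function G_star :: "'a topology \<Rightarrow> omega1 \<Rightarrow> 'a set set" where
  "G_star S \<alpha> =
     (if \<alpha> = 0 then {A. cozero_set_in S A}
      else if odd_ord \<alpha>
      then {(\<Inter>n. B n) |B :: nat \<Rightarrow> 'a set. \<forall>n. \<exists>\<xi>\<in>{..<\<alpha>}. B n \<in> G_star S \<xi>}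
      else {(\<Union>n. B n) |B :: nat \<Rightarrow> 'a set. \<forall>n. \<exists>\<xi>\<in>{..<\<alpha>}. B n \<in> G_star S \<xi>})"
  by pat_completeness auto
termination by (relation "inv_image {(\<xi>, \<alpha>). \<xi> < \<alpha>} snd") (auto intro: wf)

function F_star :: "'a topology \<Rightarrow> omega1 \<Rightarrow> 'a set set" where
  "F_star S \<alpha> =
     (if \<alpha> = 0 then {A. zero_set_in S A}
      else if odd_ord \<alpha>
      then {(\<Union>n. B n) |B :: nat \<Rightarrow> 'a set. \<forall>n. \<exists>\<xi>\<in>{..<\<alpha>}. B n \<in> F_star S \<xi>}
      else {(\<Inter>n. B n) |B :: nat \<Rightarrow> 'a set. \<forall>n. \<exists>\<xi>\<in>{..<\<alpha>}. B n \<in> F_star S \<xi>})"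
  by pat_completeness auto
termination by (relation "inv_image {(\<xi>, \<alpha>). \<xi> < \<alpha>} snd") (auto intro: wf)

declare G_star.simps [simp del] F_star.simps [simp del]

definition functionally_additive :: "omega1 \<Rightarrow> 'a topology \<Rightarrow> 'a set set" where
  "functionally_additive \<alpha> S = (if odd_ord \<alpha> then F_star S \<alpha> else G_star S \<alpha>)"

definition H_star :: "omega1 \<Rightarrow> 'a topology \<Rightarrow> 'b topology \<Rightarrow> ('a \<Rightarrow> 'b) set" where
  "H_star \<alpha> S T =
     {g \<in> topspace S \<rightarrow> topspace T.
        \<forall>V. openin T V \<longrightarrow> {x \<in> topspace S. g x \<in> V} \<in> functionally_additive \<alpha> S}"

definition dense_in :: "'a topology \<Rightarrow> 'a set \<Rightarrow> bool" where
  "dense_in X D \<longleftrightarrow> D \<subseteq> topspace X \<and> X closure_of D = topspace X"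

definition CH_bar ::
  "omega1 \<Rightarrow> 'a topology \<Rightarrow> 'b topology \<Rightarrow> 'c topology \<Rightarrow> ('a \<times> 'b \<Rightarrow> 'c) set" where
  "CH_bar \<alpha> X Y Z =
     {f \<in> topspace (prod_topology X Y) \<rightarrow> topspace Z.
        (\<forall>y \<in> topspace Y. continuous_map X Z (\<lambda>x. f (x, y))) \<and>
        dense_in X {x \<in> topspace X. (\<lambda>y. f (x, y)) \<in> H_star \<alpha> Y Z}}"


section \<open>Strong PP-spaces and perfectly normal spaces\<close>

text \<open>Local finiteness of an indexed family; unlike \<^const>\<open>locally_finite_in\<close>, which concerns
  sets of sets, it counts indices.\<close>

definition locally_finite_cover ::
  "'a topology \<Rightarrow> 'i set \<Rightarrow> ('i \<Rightarrow> 'a set) \<Rightarrow> bool" where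
  "locally_finite_cover X I U \<longleftrightarrow>
     (\<Union>i\<in>I. U i) = topspace X \<and>
     (\<forall>x \<in> topspace X. \<exists>W. openin X W \<and> x \<in> W \<and> finite {i \<in> I. U i \<inter> W \<noteq> {}})"

definition PP_families ::
  "'a topology \<Rightarrow> 'a set \<Rightarrow> (nat \<Rightarrow> 'i set) \<Rightarrow> (nat \<Rightarrow> 'i \<Rightarrow> 'a set) \<Rightarrow> (nat \<Rightarrow> 'i \<Rightarrow> 'a) \<Rightarrow> bool" where
  "PP_families X D I U p \<longleftrightarrow>
     (\<forall>n. locally_finite_cover X (I n) (U n) \<and>
          (\<forall>i \<in> I n. cozero_set_in X (U n i) \<and> p n i \<in> D)) \<and>
     (\<forall>x \<in> topspace X. \<forall>j. (\<forall>n. j n \<in> I n \<and> x \<in> U n (j n)) \<longrightarrow>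
          limitin X (\<lambda>n. p n (j n)) x sequentially)"

text \<open>An existential quantifier cannot range over types, so the index sets are taken inside
  \<^typ>\<open>'a set \<times> 'a\<close>. By \<open>strong_PP_spaceI\<close> below this loses no generality: discarding
  empty members and identifying indices with equal pair \<open>(U n i, p n i)\<close> turns families over
  any index type into families over this one.\<close>

definition strong_PP_space :: "'a topology \<Rightarrow> bool" where
  "strong_PP_space X \<longleftrightarrow>
     (\<forall>D. dense_in X D \<longrightarrow>
        (\<exists>(I :: nat \<Rightarrow> ('a set \<times> 'a) set) U p. PP_families X D I U p))"

lemma PP_families_reindex:
  fixes I :: "nat \<Rightarrow> 'i set" and X :: "'a topology"
  assumes "PP_families X D I U p"
  shows "\<exists>(J :: nat \<Rightarrow> ('a set \<times> 'a) set) V q. PP_families X D J V q"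
proof -
  define K where "K n = {i \<in> I n. U n i \<noteq> {}}" for n
  define h where "h n i = (U n i, p n i)" for n i
  define J where "J n = h n ` K n" for n
  have cov: "(\<Union>i\<in>I n. U n i) = topspace X"
    and lf: "\<And>x. x \<in> topspace X \<Longrightarrow> \<exists>W. openin X W \<and> x \<in> W \<and> finite {i \<in> I n. U n i \<inter> W \<noteq> {}}"
    and mem: "\<And>i. i \<in> I n \<Longrightarrow> cozero_set_in X (U n i) \<and> p n i \<in> D" for n
    using assms by (auto simp: PP_families_def locally_finite_cover_def)
  have lim: "limitin X (\<lambda>n. p n (j n)) x sequentially"
    if "x \<in> topspace X" "\<And>n. j n \<in> I n \<and> x \<in> U n (j n)" for x j
    using assms that unfolding PP_families_def by blast
  have "PP_families X D J (\<lambda>n. fst) (\<lambda>n. snd)"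
    unfolding PP_families_def locally_finite_cover_def
  proof (intro conjI allI ballI impI)
    fix n
    show "(\<Union>i\<in>J n. fst i) = topspace X"
      unfolding cov[of n, symmetric] by (auto simp: J_def K_def h_def)
    fix x assume "x \<in> topspace X"
    then obtain W where W: "openin X W" "x \<in> W" "finite {i \<in> I n. U n i \<inter> W \<noteq> {}}"
      using lf by blast
    have "{i \<in> J n. fst i \<inter> W \<noteq> {}} \<subseteq> h n ` {i \<in> I n. U n i \<inter> W \<noteq> {}}"
      unfolding J_def K_def h_def by (intro subsetI, elim CollectE conjE imageE) (intro image_eqI, auto)
    then have "finite {i \<in> J n. fst i \<inter> W \<noteq> {}}"
      using W(3) finite_surj by blast
    with W show "\<exists>W. openin X W \<and> x \<in> W \<and> finite {i \<in> J n. fst i \<inter> W \<noteq> {}}" by blast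
  next
    fix n i assume "i \<in> J n"
    then show "cozero_set_in X (fst i)" "snd i \<in> D"
      using mem by (auto simp: J_def K_def h_def)
  next
    fix x j assume x: "x \<in> topspace X" and j: "\<forall>n. j n \<in> J n \<and> x \<in> fst (j n)"
    then have "\<forall>n. \<exists>i. i \<in> I n \<and> j n = h n i" by (auto simp: J_def K_def)
    then obtain k where k: "\<And>n. k n \<in> I n \<and> j n = h n (k n)" by metis
    then have "limitin X (\<lambda>n. p n (k n)) x sequentially"
      using j by (intro lim x) (auto simp: h_def)
    then show "limitin X (\<lambda>n. snd (j n)) x sequentially"
      using k by (simp add: h_def)
  qed
  then show ?thesis by blast
qed

lemma strong_PP_spaceI:
  assumes "\<And>D. dense_in X D \<Longrightarrow> \<exists>(I :: nat \<Rightarrow> 'i set) U p. PP_families X D I U p"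
  shows "strong_PP_space X"
  unfolding strong_PP_space_def using assms PP_families_reindex by blast

definition perfectly_normal_space :: "'a topology \<Rightarrow> bool" where
  "perfectly_normal_space X \<longleftrightarrow> normal_space X \<and> (\<forall>C. closedin X C \<longrightarrow> gdelta_in X C)"

end

(* Let x_{i,n} and U_{i,n} come from the strong PP property for the dense set of good points, and
   write an open V as a union of open Q_m with closure of Q_m inside V. As x_{i_n,n} tends to x
   whenever x lies in every U_{i_n,n}, the point f(x,y) lies in V iff for some m and all large n,
   f(x_{i,n},y) lies in the closure of Q_m for every i with x in U_{i,n}. For fixed n the negation
   of the last condition is a locally finite union of rectangles U_{i,n} x B with B additive of
   class alpha, so everything reduces to showing that such unions are additive of class alpha.
   Overlapping rectangles do not commute with intersections, so the cover is first refined to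
   countably many disjoint locally finite families; for these one inducts on the class. *)

theory Submission
  imports Defs
begin

section \<open>Co-zero sets\<close>

lemma continuous_map_compose_fst:
  "continuous_map X Z f \<Longrightarrow> continuous_map (prod_topology X Y) Z (\<lambda>z. f (fst z))"
  using continuous_map_compose[OF continuous_map_fst, of X Z f Y] by (simp add: o_def)

lemma continuous_map_compose_snd:
  "continuous_map Y Z f \<Longrightarrow> continuous_map (prod_topology X Y) Z (\<lambda>z. f (snd z))"
  using continuous_map_compose[OF continuous_map_snd, of Y Z f X] by (simp add: o_def)

text \<open>Only the sign of \<open>g\<close> matters, so truncating it to [0,1] leaves the set
  unchanged.\<close>

lemma cozero_set_inI:
  fixes g :: "'a \<Rightarrow> real"
  assumes "continuous_map S euclideanreal g"
  shows "cozero_set_in S {x \<in> topspace S. 0 < g x}"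
  unfolding cozero_set_in_def
proof (intro exI conjI)
  show "continuous_map S (top_of_set {0..1}) (\<lambda>x. max 0 (min 1 (g x)))"
    unfolding continuous_map_in_subtopology
    by (intro conjI continuous_intros assms) auto
qed auto

lemma cozero_set_inE:
  assumes "cozero_set_in S A"
  obtains g :: "'a \<Rightarrow> real" where "continuous_map S euclideanreal g"
    "\<And>x. x \<in> topspace S \<Longrightarrow> 0 \<le> g x \<and> g x \<le> 1" "A = {x \<in> topspace S. 0 < g x}"
proof -
  obtain g where g: "continuous_map S (top_of_set {0..1::real}) g"
    "A = {x \<in> topspace S. g x \<in> {0<..1}}"
    using assms unfolding cozero_set_in_def by blast
  then have "continuous_map S euclideanreal g" and im: "g \<in> topspace S \<rightarrow> {0..1}"
    by (auto simp: continuous_map_in_subtopology)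
  moreover have "A = {x \<in> topspace S. 0 < g x}"
    using im by (auto simp: g(2))
  ultimately show thesis using im by (intro that) auto
qed

lemma cozero_set_in_family:
  assumes "\<And>i. i \<in> I \<Longrightarrow> cozero_set_in S (A i)"
  shows "\<exists>g :: 'i \<Rightarrow> 'a \<Rightarrow> real. \<forall>i\<in>I. continuous_map S euclideanreal (g i) \<and>
    (\<forall>x\<in>topspace S. 0 \<le> g i x \<and> g i x \<le> 1) \<and> A i = {x \<in> topspace S. 0 < g i x}"
  using assms by (intro bchoice) (metis cozero_set_inE)

lemma cozero_set_in_subset: "cozero_set_in S A \<Longrightarrow> A \<subseteq> topspace S"
  by (auto simp: cozero_set_in_def)

lemma cozero_set_in_empty: "cozero_set_in S {}"
  using cozero_set_inI[of S "\<lambda>_. 0"] by simp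

lemma cozero_set_in_topspace: "cozero_set_in S (topspace S)"
  using cozero_set_inI[of S "\<lambda>_. 1"] by simp

section \<open>Suprema of families of functions, with 0 inserted\<close>

lemma less_Sup_insert_zero_iff:
  fixes g :: "'i \<Rightarrow> real"
  assumes "\<And>i. i \<in> I \<Longrightarrow> g i \<le> 1" "0 \<le> a"
  shows "a < Sup (insert 0 (g ` I)) \<longleftrightarrow> (\<exists>i\<in>I. a < g i)"
proof -
  have "bdd_above (insert 0 (g ` I))"
    using assms(1) by (auto simp: bdd_above_def intro!: exI[of _ 1])
  \<comment> \<open>The inserted 0 gives even an empty family a supremum. As \<open>a\<close> is
    nonnegative, 0 never exceeds it, so only members of the family count.\<close>
  then show ?thesis
    using assms(2) by (subst less_cSup_iff) auto
qed

lemma Sup_insert_zero_upper: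
  fixes g :: "'i \<Rightarrow> real"
  assumes "\<And>i. i \<in> I \<Longrightarrow> g i \<le> 1"
  shows "0 \<le> Sup (insert 0 (g ` I))" "i \<in> I \<Longrightarrow> g i \<le> Sup (insert 0 (g ` I))"
proof -
  have "bdd_above (insert 0 (g ` I))"
    using assms(1) by (auto simp: bdd_above_def intro!: exI[of _ 1])
  then show "0 \<le> Sup (insert 0 (g ` I))" "i \<in> I \<Longrightarrow> g i \<le> Sup (insert 0 (g ` I))"
    by (auto intro: cSup_upper)
qed

text \<open>The local smallness hypothesis covers both locally finite families and sequences
  dominated by a null sequence.\<close>

lemma continuous_map_Sup_locally_small:
  fixes g :: "'i \<Rightarrow> 'a \<Rightarrow> real"
  assumes cont: "\<And>i. i \<in> I \<Longrightarrow> continuous_map S euclideanreal (g i)"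
    and bound: "\<And>i x. i \<in> I \<Longrightarrow> x \<in> topspace S \<Longrightarrow> g i x \<le> 1"
    and small: "\<And>x \<epsilon>. x \<in> topspace S \<Longrightarrow> 0 < \<epsilon> \<Longrightarrow>
      \<exists>W. openin S W \<and> x \<in> W \<and> finite {i \<in> I. \<exists>z\<in>W. \<epsilon> < g i z}"
  shows "continuous_map S euclideanreal (\<lambda>x. Sup (insert 0 ((\<lambda>i. g i x) ` I)))"
    (is "continuous_map _ _ ?s")
  unfolding continuous_map_upper_lower_semicontinuous_lt
proof (intro conjI allI)
  fix a :: real
  show "openin S {x \<in> topspace S. ?s x > a}"
  \<comment> \<open>The supremum is nonnegative, so a negative \<open>a\<close> yields the whole
    space. For other \<open>a\<close> the set is a union of open sets, one per index.\<close>
  proof (cases "a < 0")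
    case True
    then have "{x \<in> topspace S. ?s x > a} = topspace S"
      using Sup_insert_zero_upper(1)[of I] bound by (force intro: less_le_trans)
    then show ?thesis by simp
  next
    case False
    then have "{x \<in> topspace S. ?s x > a} = (\<Union>i\<in>I. {x \<in> topspace S. g i x > a})"
      using bound by (auto simp: less_Sup_insert_zero_iff)
    moreover have "openin S {x \<in> topspace S. g i x > a}" if "i \<in> I" for i
      using cont[OF that] unfolding continuous_map_upper_lower_semicontinuous_lt by blast
    ultimately show ?thesis by (metis (no_types, lifting) openin_Union imageE)
  qed
  show "openin S {x \<in> topspace S. ?s x < a}"
  proof (subst openin_subopen, intro ballI)
    fix x assume "x \<in> {x \<in> topspace S. ?s x < a}"
    then have x: "x \<in> topspace S" and "?s x < a" by auto
    \<comment> \<open>The intermediate level leaves room: near \<open>x\<close> all members will be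
      at most \<epsilon>, hence so is the supremum, which thus stays strictly below
      \<open>a\<close>.\<close>
    then obtain \<epsilon> where \<epsilon>: "?s x < \<epsilon>" "\<epsilon> < a" using dense by blast
    then have "0 < \<epsilon>"
      using Sup_insert_zero_upper(1)[of I "\<lambda>i. g i x"] bound x by force
    then obtain W where W: "openin S W" "x \<in> W" and fin: "finite {i \<in> I. \<exists>z\<in>W. \<epsilon> < g i z}"
      using small x by blast
    \<comment> \<open>Off the finite index set the members are at most \<epsilon> on all of
      \<open>W\<close>; the finitely many others are controlled by open conditions that hold at
      \<open>x\<close>.\<close>
    define W' where "W' = W \<inter> (\<Inter>i\<in>{i \<in> I. \<exists>z\<in>W. \<epsilon> < g i z}. {z \<in> topspace S. g i z < \<epsilon>})"
    have "openin S {z \<in> topspace S. g i z < \<epsilon>}" if "i \<in> I" for i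
      using cont[OF that] unfolding continuous_map_upper_lower_semicontinuous_lt by blast
    then have "openin S W'"
      unfolding W'_def using W fin
      by (cases "{i \<in> I. \<exists>z\<in>W. \<epsilon> < g i z} = {}")
        (auto simp del: Collect_empty_eq intro!: openin_Int openin_INT)
    moreover have "g i x < \<epsilon>" if "i \<in> I" for i
      using Sup_insert_zero_upper(2)[of I "\<lambda>i. g i x", OF bound[OF _ x] that] \<epsilon>(1) by simp
    then have "x \<in> W'"
      unfolding W'_def using W(2) x by simp
    moreover have "?s z < a" if "z \<in> W'" for z
    proof -
      have "g i z \<le> \<epsilon>" if "i \<in> I" for i
        using \<open>z \<in> W'\<close> that unfolding W'_def by force
      then have "?s z \<le> \<epsilon>" using \<open>0 < \<epsilon>\<close> by (intro cSup_least) auto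
      with \<epsilon> show ?thesis by simp
    qed
    moreover have "W' \<subseteq> topspace S"
      using W openin_subset unfolding W'_def by blast
    ultimately show "\<exists>T. openin S T \<and> x \<in> T \<and> T \<subseteq> {x \<in> topspace S. ?s x < a}"
      by blast
  qed
qed

text \<open>A supremum exceeds 0 exactly when some member does, so the union is the positivity set
  of a single continuous function.\<close>

lemma cozero_set_in_Union_locally_small:
  fixes g :: "'i \<Rightarrow> 'a \<Rightarrow> real"
  assumes "\<And>i. i \<in> I \<Longrightarrow> continuous_map S euclideanreal (g i)"
    and "\<And>i x. i \<in> I \<Longrightarrow> x \<in> topspace S \<Longrightarrow> g i x \<le> 1"
    and "\<And>x \<epsilon>. x \<in> topspace S \<Longrightarrow> 0 < \<epsilon> \<Longrightarrow>
      \<exists>W. openin S W \<and> x \<in> W \<and> finite {i \<in> I. \<exists>z\<in>W. \<epsilon> < g i z}"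
  shows "cozero_set_in S (\<Union>i\<in>I. {x \<in> topspace S. 0 < g i x})"
proof -
  have "(\<Union>i\<in>I. {x \<in> topspace S. 0 < g i x}) =
      {x \<in> topspace S. 0 < Sup (insert 0 ((\<lambda>i. g i x) ` I))}"
    using assms(2) by (auto simp: less_Sup_insert_zero_iff)
  then show ?thesis
    using cozero_set_inI[OF continuous_map_Sup_locally_small, of I S g] assms by simp
qed

lemma cozero_set_in_countable_Union:
  fixes A :: "nat \<Rightarrow> 'a set"
  assumes "\<And>n. cozero_set_in S (A n)"
  shows "cozero_set_in S (\<Union>n. A n)"
proof -
  obtain g :: "nat \<Rightarrow> 'a \<Rightarrow> real" where g: "\<And>n. continuous_map S euclideanreal (g n)"
    "\<And>n x. x \<in> topspace S \<Longrightarrow> 0 \<le> g n x \<and> g n x \<le> 1"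
    "\<And>n. A n = {x \<in> topspace S. 0 < g n x}"
    using cozero_set_in_family[of UNIV S A, OF assms] by blast
  \<comment> \<open>The weights leave the positivity sets unchanged but make the sequence uniformly
    small from some index on, so the whole space serves as the neighbourhood of every point.\<close>
  have le: "(1/2) ^ n * g n x \<le> (1/2) ^ n" if "x \<in> topspace S" for n x
    using mult_left_mono[of "g n x" 1 "(1/2) ^ n"] g(2)[OF that, of n] by simp
  have "cozero_set_in S (\<Union>n\<in>UNIV. {x \<in> topspace S. 0 < (1/2) ^ n * g n x})"
  proof (rule cozero_set_in_Union_locally_small)
    show "continuous_map S euclideanreal (\<lambda>x. (1/2) ^ n * g n x)" for n
      by (intro continuous_intros g)
    show "(1/2) ^ n * g n x \<le> 1" if "x \<in> topspace S" for n x
      using le[OF that, of n] power_le_one[of "1/2::real" n] by linarith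
    fix x and \<epsilon> :: real assume x: "x \<in> topspace S" and "0 < \<epsilon>"
    then obtain N where N: "(1/2) ^ N < \<epsilon>"
      using real_arch_pow_inv[of \<epsilon> "1/2"] by auto
    have "(1/2) ^ n * g n z \<le> \<epsilon>" if "z \<in> topspace S" "N \<le> n" for n z
      using le[OF that(1), of n] N power_decreasing[OF that(2), of "1/2::real"] by linarith
    then have "{n \<in> UNIV. \<exists>z\<in>topspace S. \<epsilon> < (1/2) ^ n * g n z} \<subseteq> {..<N}"
      by (force simp: not_less[symmetric])
    then have "finite {n \<in> UNIV. \<exists>z\<in>topspace S. \<epsilon> < (1/2) ^ n * g n z}"
      using finite_subset by blast
    with x show "\<exists>W. openin S W \<and> x \<in> W \<and> finite {n \<in> UNIV. \<exists>z\<in>W. \<epsilon> < (1/2) ^ n * g n z}"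
      by blast
  qed
  then show ?thesis by (simp add: g(3) zero_less_mult_iff)
qed

text \<open>Separated from \<open>locally_finite_cover\<close> because the families of refined sets
  and of rectangles below need not cover the space.\<close>

definition locally_finite_family :: "'a topology \<Rightarrow> 'i set \<Rightarrow> ('i \<Rightarrow> 'a set) \<Rightarrow> bool" where
  "locally_finite_family X I U \<longleftrightarrow>
     (\<forall>x \<in> topspace X. \<exists>W. openin X W \<and> x \<in> W \<and> finite {i \<in> I. U i \<inter> W \<noteq> {}})"

lemma locally_finite_familyE:
  assumes "locally_finite_family X I U" "x \<in> topspace X"
  obtains W where "openin X W" "x \<in> W" "finite {i \<in> I. U i \<inter> W \<noteq> {}}"
  using assms unfolding locally_finite_family_def by blast

lemma cozero_set_in_Union_locally_finite:
  fixes U :: "'i \<Rightarrow> 'a set"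
  assumes cz: "\<And>i. i \<in> I \<Longrightarrow> cozero_set_in S (U i)" and lf: "locally_finite_family S I U"
  shows "cozero_set_in S (\<Union>i\<in>I. U i)"
proof -
  obtain g :: "'i \<Rightarrow> 'a \<Rightarrow> real" where
    g: "\<And>i. i \<in> I \<Longrightarrow> continuous_map S euclideanreal (g i)"
    "\<And>i x. i \<in> I \<Longrightarrow> x \<in> topspace S \<Longrightarrow> 0 \<le> g i x \<and> g i x \<le> 1"
    "\<And>i. i \<in> I \<Longrightarrow> U i = {x \<in> topspace S. 0 < g i x}"
    using cozero_set_in_family[of I _ U, OF cz] by metis
  have "cozero_set_in S (\<Union>i\<in>I. {x \<in> topspace S. 0 < g i x})"
  proof (rule cozero_set_in_Union_locally_small)
    fix x and \<epsilon> :: real assume x: "x \<in> topspace S" and "0 < \<epsilon>"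
    obtain W where W: "openin S W" "x \<in> W" "finite {i \<in> I. U i \<inter> W \<noteq> {}}"
      using locally_finite_familyE[OF lf x] .
    \<comment> \<open>One neighbourhood serves all \<epsilon>: a value above \<epsilon> at a point
      of \<open>W\<close> already puts that point into \<open>U i\<close>.\<close>
    have "{i \<in> I. \<exists>z\<in>W. \<epsilon> < g i z} \<subseteq> {i \<in> I. U i \<inter> W \<noteq> {}}"
      using g(3) \<open>0 < \<epsilon>\<close> openin_subset[OF W(1)] by force
    with W show "\<exists>W. openin S W \<and> x \<in> W \<and> finite {i \<in> I. \<exists>z\<in>W. \<epsilon> < g i z}"
      using finite_subset by blast
  qed (use g in auto)
  then show ?thesis using g(3) by simp
qed

lemma cozero_set_in_Times:
  assumes "cozero_set_in X A" "cozero_set_in Y B"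
  shows "cozero_set_in (prod_topology X Y) (A \<times> B)"
proof -
  obtain g :: "'a \<Rightarrow> real" where g: "continuous_map X euclideanreal g"
    "\<And>x. x \<in> topspace X \<Longrightarrow> 0 \<le> g x \<and> g x \<le> 1" "A = {x \<in> topspace X. 0 < g x}"
    using cozero_set_inE[OF assms(1)] by metis
  obtain h :: "'b \<Rightarrow> real" where h: "continuous_map Y euclideanreal h"
    "\<And>x. x \<in> topspace Y \<Longrightarrow> 0 \<le> h x \<and> h x \<le> 1" "B = {x \<in> topspace Y. 0 < h x}"
    using cozero_set_inE[OF assms(2)] by metis
  have "A \<times> B = {z \<in> topspace (prod_topology X Y). 0 < min (g (fst z)) (h (snd z))}"
    by (auto simp: g(3) h(3))
  then show ?thesis
    by (metis (no_types) cozero_set_inI continuous_map_real_min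
        continuous_map_compose_fst[OF g(1)] continuous_map_compose_snd[OF h(1)])
qed

text \<open>The strip over a neighbourhood in \<open>X\<close> meets only rectangles whose first
  sides meet that neighbourhood, so the second sides may be arbitrary.\<close>

lemma locally_finite_family_Times:
  assumes "locally_finite_family X I U"
  shows "locally_finite_family (prod_topology X Y) I (\<lambda>i. U i \<times> B i)"
  unfolding locally_finite_family_def
proof
  fix z assume z: "z \<in> topspace (prod_topology X Y)"
  then have "fst z \<in> topspace X" by auto
  then obtain W where W: "openin X W" "fst z \<in> W" "finite {i \<in> I. U i \<inter> W \<noteq> {}}"
    by (rule locally_finite_familyE[OF assms])
  have "openin (prod_topology X Y) (W \<times> topspace Y)" "z \<in> W \<times> topspace Y"
    using W z by (auto simp: openin_prod_Times_iff mem_Times_iff)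
  moreover have "{i \<in> I. (U i \<times> B i) \<inter> (W \<times> topspace Y) \<noteq> {}} \<subseteq> {i \<in> I. U i \<inter> W \<noteq> {}}"
    by blast
  ultimately show "\<exists>W. openin (prod_topology X Y) W \<and> z \<in> W \<and> finite {i \<in> I. (U i \<times> B i) \<inter> W \<noteq> {}}"
    using W(3) finite_subset by blast
qed

section \<open>Functional classes\<close>

lemma G_star_zero: "A \<in> G_star S 0 \<longleftrightarrow> cozero_set_in S A"
  by (subst G_star.simps) simp

lemma F_star_zero: "A \<in> F_star S 0 \<longleftrightarrow> zero_set_in S A"
  by (subst F_star.simps) simp

text \<open>Since 0 is even, oddness alone excludes the base case of the recursion.\<close>

lemma G_star_odd:
  "odd_ord \<alpha> \<Longrightarrow> A \<in> G_star S \<alpha> \<longleftrightarrow> (\<exists>B. A = (\<Inter>n::nat. B n) \<and> (\<forall>n. \<exists>\<xi><\<alpha>. B n \<in> G_star S \<xi>))"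
  using even_ord_zero by (subst G_star.simps) (simp add: Bex_def, metis)

lemma F_star_odd:
  "odd_ord \<alpha> \<Longrightarrow> A \<in> F_star S \<alpha> \<longleftrightarrow> (\<exists>B. A = (\<Union>n::nat. B n) \<and> (\<forall>n. \<exists>\<xi><\<alpha>. B n \<in> F_star S \<xi>))"
  using even_ord_zero by (subst F_star.simps) (simp add: Bex_def, metis)

lemma G_star_even:
  "even_ord \<alpha> \<Longrightarrow> \<alpha> \<noteq> 0 \<Longrightarrow>
    A \<in> G_star S \<alpha> \<longleftrightarrow> (\<exists>B. A = (\<Union>n::nat. B n) \<and> (\<forall>n. \<exists>\<xi><\<alpha>. B n \<in> G_star S \<xi>))"
  by (subst G_star.simps) (simp add: Bex_def)

lemma F_star_even:
  "even_ord \<alpha> \<Longrightarrow> \<alpha> \<noteq> 0 \<Longrightarrow>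
    A \<in> F_star S \<alpha> \<longleftrightarrow> (\<exists>B. A = (\<Inter>n::nat. B n) \<and> (\<forall>n. \<exists>\<xi><\<alpha>. B n \<in> F_star S \<xi>))"
  by (subst F_star.simps) (simp add: Bex_def)

lemma omega1_pos: "\<alpha> \<noteq> 0 \<Longrightarrow> 0 < (\<alpha>::omega1)"
  using omega1_zero_le[of \<alpha>] by (simp add: order.order_iff_strict)

lemma odd_ord_pos: "odd_ord \<alpha> \<Longrightarrow> 0 < \<alpha>"
  using even_ord_zero omega1_pos by metis

lemma G_star_subset: "A \<in> G_star S \<alpha> \<Longrightarrow> A \<subseteq> topspace S"
proof (induction \<alpha> arbitrary: A rule: less_induct)
  case (less \<alpha>)
  consider "\<alpha> = 0" | "odd_ord \<alpha>" | "even_ord \<alpha>" "\<alpha> \<noteq> 0" by blast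
  then show ?case
  proof cases
    case 1
    then show ?thesis using less.prems by (simp add: G_star_zero cozero_set_in_subset)
  next
    case 2
    with less show ?thesis unfolding G_star_odd[OF 2] by blast
  next
    case 3
    with less show ?thesis unfolding G_star_even[OF 3] by blast
  qed
qed

lemma F_star_subset: "A \<in> F_star S \<alpha> \<Longrightarrow> A \<subseteq> topspace S"
proof (induction \<alpha> arbitrary: A rule: less_induct)
  case (less \<alpha>)
  consider "\<alpha> = 0" | "odd_ord \<alpha>" | "even_ord \<alpha>" "\<alpha> \<noteq> 0" by blast
  then show ?case
  proof cases
    case 1
    then show ?thesis using less.prems by (auto simp: F_star_zero zero_set_in_def)
  next
    case 2
    with less show ?thesis unfolding F_star_odd[OF 2] by blast
  next
    case 3
    with less show ?thesis unfolding F_star_even[OF 3] by blast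
  qed
qed

section \<open>Duality of the two hierarchies under complements\<close>

lemma zero_set_in_Diff_cozero: "cozero_set_in S A \<Longrightarrow> zero_set_in S (topspace S - A)"
  unfolding cozero_set_in_def zero_set_in_def
  by (fastforce simp: continuous_map_in_subtopology Pi_iff)

lemma cozero_set_in_Diff_zero: "zero_set_in S A \<Longrightarrow> cozero_set_in S (topspace S - A)"
  unfolding cozero_set_in_def zero_set_in_def
  by (fastforce simp: continuous_map_in_subtopology Pi_iff)

text \<open>De Morgan at every stage: at each positive rank one hierarchy takes unions where the
  other takes intersections, so complementing preserves the rank.\<close>

lemma G_star_imp_F_star_Diff: "A \<in> G_star S \<alpha> \<Longrightarrow> topspace S - A \<in> F_star S \<alpha>"
proof (induction \<alpha> arbitrary: A rule: less_induct)
  case (less \<alpha>)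
  consider "\<alpha> = 0" | "odd_ord \<alpha>" | "even_ord \<alpha>" "\<alpha> \<noteq> 0" by blast
  then show ?case
  proof cases
    case 1
    then show ?thesis using less.prems
      by (simp add: G_star_zero F_star_zero zero_set_in_Diff_cozero)
  next
    case 2
    obtain B where B: "A = (\<Inter>n::nat. B n)" "\<forall>n. \<exists>\<xi><\<alpha>. B n \<in> G_star S \<xi>"
      using less.prems unfolding G_star_odd[OF 2] by blast
    have "topspace S - A = (\<Union>n. topspace S - B n)" using B(1) by blast
    moreover have "\<forall>n. \<exists>\<xi><\<alpha>. topspace S - B n \<in> F_star S \<xi>" using B(2) less.IH by blast
    ultimately show ?thesis unfolding F_star_odd[OF 2] by metis
  next
    case 3
    obtain B where B: "A = (\<Union>n::nat. B n)" "\<forall>n. \<exists>\<xi><\<alpha>. B n \<in> G_star S \<xi>"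
      using less.prems unfolding G_star_even[OF 3] by blast
    have "topspace S - A = (\<Inter>n. topspace S - B n)" using B(1) by blast
    moreover have "\<forall>n. \<exists>\<xi><\<alpha>. topspace S - B n \<in> F_star S \<xi>" using B(2) less.IH by blast
    ultimately show ?thesis unfolding F_star_even[OF 3] by metis
  qed
qed

lemma F_star_imp_G_star_Diff: "A \<in> F_star S \<alpha> \<Longrightarrow> topspace S - A \<in> G_star S \<alpha>"
proof (induction \<alpha> arbitrary: A rule: less_induct)
  case (less \<alpha>)
  consider "\<alpha> = 0" | "odd_ord \<alpha>" | "even_ord \<alpha>" "\<alpha> \<noteq> 0" by blast
  then show ?case
  proof cases
    case 1
    then show ?thesis using less.prems
      by (simp add: G_star_zero F_star_zero cozero_set_in_Diff_zero)
  next
    case 2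
    obtain B where B: "A = (\<Union>n::nat. B n)" "\<forall>n. \<exists>\<xi><\<alpha>. B n \<in> F_star S \<xi>"
      using less.prems unfolding F_star_odd[OF 2] by blast
    have "topspace S - A = (\<Inter>n. topspace S - B n)" using B(1) by blast
    moreover have "\<forall>n. \<exists>\<xi><\<alpha>. topspace S - B n \<in> G_star S \<xi>" using B(2) less.IH by blast
    ultimately show ?thesis unfolding G_star_odd[OF 2] by metis
  next
    case 3
    obtain B where B: "A = (\<Inter>n::nat. B n)" "\<forall>n. \<exists>\<xi><\<alpha>. B n \<in> F_star S \<xi>"
      using less.prems unfolding F_star_even[OF 3] by blast
    have "topspace S - A = (\<Union>n. topspace S - B n)" using B(1) by blast
    moreover have "\<forall>n. \<exists>\<xi><\<alpha>. topspace S - B n \<in> G_star S \<xi>" using B(2) less.IH by blast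
    ultimately show ?thesis unfolding G_star_even[OF 3] by metis
  qed
qed

text \<open>This allows later arguments to run in \<open>G_star\<close> alone, with
  \<open>F_star\<close> reached through complements.\<close>

lemma F_star_iff_G_star_Diff:
  "A \<subseteq> topspace S \<Longrightarrow> A \<in> F_star S \<alpha> \<longleftrightarrow> topspace S - A \<in> G_star S \<alpha>"
  by (metis F_star_imp_G_star_Diff G_star_imp_F_star_Diff double_diff order_refl)

section \<open>Closure properties of the classes \<open>G_star\<close>\<close>

lemma G_star_mono:
  assumes "A \<in> G_star S \<xi>" "\<xi> \<le> \<alpha>"
  shows "A \<in> G_star S \<alpha>"
proof (cases "\<xi> = \<alpha>")
  case False
  with assms(2) have lt: "\<xi> < \<alpha>" by simp
  then have "\<alpha> \<noteq> 0" using omega1_zero_le[of \<xi>] by auto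
  \<comment> \<open>The constant sequence serves at both parities.\<close>
  have "\<forall>n::nat. \<exists>\<xi><\<alpha>. A \<in> G_star S \<xi>" "A = (\<Inter>n::nat. A)" "A = (\<Union>n::nat. A)"
    using lt assms(1) by auto
  with \<open>\<alpha> \<noteq> 0\<close> show ?thesis
    by (cases "even_ord \<alpha>") (metis G_star_even, metis G_star_odd)
qed (use assms in simp)

lemma UN_prod_decode: "(\<Union>n. \<Union>k. B n k) = (\<Union>p. case_prod B (prod_decode p))"
proof -
  have "(\<Union>n. \<Union>k. B n k) = (\<Union>q\<in>range prod_decode. case_prod B q)"
    unfolding surj_prod_decode by auto
  then show ?thesis by (simp only: image_image)
qed

lemma INT_prod_decode: "(\<Inter>n. \<Inter>k. B n k) = (\<Inter>p. case_prod B (prod_decode p))"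
proof -
  have "(\<Inter>n. \<Inter>k. B n k) = (\<Inter>q\<in>range prod_decode. case_prod B q)"
    unfolding surj_prod_decode by auto
  then show ?thesis by (simp only: image_image)
qed

text \<open>At positive rank each set is itself a union of sets of lower rank, and a pairing
  function flattens the double union. Only rank 0 needs the analytic fact on co-zero sets.\<close>

lemma G_star_countable_Union:
  assumes "even_ord \<alpha>" "\<And>n::nat. A n \<in> G_star S \<alpha>"
  shows "(\<Union>n. A n) \<in> G_star S \<alpha>"
proof (cases "\<alpha> = 0")
  case True
  then show ?thesis using assms by (simp add: G_star_zero cozero_set_in_countable_Union)
next
  case False
  have "\<forall>n. \<exists>B. A n = (\<Union>k::nat. B k) \<and> (\<forall>k. \<exists>\<xi><\<alpha>. B k \<in> G_star S \<xi>)"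
    using assms(2) unfolding G_star_even[OF assms(1) False] by blast
  then obtain B where B: "\<And>n. A n = (\<Union>k::nat. B n k)" "\<And>n k. \<exists>\<xi><\<alpha>. B n k \<in> G_star S \<xi>"
    by metis
  have "(\<Union>n. A n) = (\<Union>p. case_prod B (prod_decode p))"
    unfolding B(1) by (rule UN_prod_decode)
  moreover have "\<forall>p. \<exists>\<xi><\<alpha>. case_prod B (prod_decode p) \<in> G_star S \<xi>"
    using B(2) by (auto split: prod.split)
  ultimately show ?thesis unfolding G_star_even[OF assms(1) False] by metis
qed

text \<open>Odd rank excludes the co-zero stage, so flattening the double intersection
  suffices.\<close>

lemma G_star_countable_Inter:
  assumes "odd_ord \<alpha>" "\<And>n::nat. A n \<in> G_star S \<alpha>"
  shows "(\<Inter>n. A n) \<in> G_star S \<alpha>"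
proof -
  have "\<forall>n. \<exists>B. A n = (\<Inter>k::nat. B k) \<and> (\<forall>k. \<exists>\<xi><\<alpha>. B k \<in> G_star S \<xi>)"
    using assms(2) unfolding G_star_odd[OF assms(1)] by blast
  then obtain B where B: "\<And>n. A n = (\<Inter>k::nat. B n k)" "\<And>n k. \<exists>\<xi><\<alpha>. B n k \<in> G_star S \<xi>"
    by metis
  have "(\<Inter>n. A n) = (\<Inter>p. case_prod B (prod_decode p))"
    unfolding B(1) by (rule INT_prod_decode)
  moreover have "\<forall>p. \<exists>\<xi><\<alpha>. case_prod B (prod_decode p) \<in> G_star S \<xi>"
    using B(2) by (auto split: prod.split)
  ultimately show ?thesis unfolding G_star_odd[OF assms(1)] by metis
qed

lemma G_star_empty: "{} \<in> G_star S \<alpha>"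
  using G_star_mono[of "{}" S 0 \<alpha>] by (simp add: G_star_zero cozero_set_in_empty omega1_zero_le)

lemma G_star_topspace: "topspace S \<in> G_star S \<alpha>"
  using G_star_mono[of "topspace S" S 0 \<alpha>]
  by (simp add: G_star_zero cozero_set_in_topspace omega1_zero_le)

text \<open>At odd rank the union distributes over both intersections; each resulting two-set union
  is handled by induction at the larger of two lower ranks.\<close>

lemma G_star_Un:
  "A \<in> G_star S \<alpha> \<Longrightarrow> B \<in> G_star S \<alpha> \<Longrightarrow> A \<union> B \<in> G_star S \<alpha>"
proof (induction \<alpha> arbitrary: A B rule: less_induct)
  case (less \<alpha>)
  show ?case
  proof (cases "even_ord \<alpha>")
    case True
    have "(\<Union>n::nat. if n = 0 then A else B) \<in> G_star S \<alpha>"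
      using less.prems by (intro G_star_countable_Union True) auto
    moreover have "(\<Union>n::nat. if n = 0 then A else B) = A \<union> B"
      by (auto split: if_splits)
    ultimately show ?thesis by simp
  next
    case False
    obtain A' where A': "A = (\<Inter>n::nat. A' n)" "\<And>n. \<exists>\<xi><\<alpha>. A' n \<in> G_star S \<xi>"
      using less.prems(1) unfolding G_star_odd[OF False] by blast
    obtain B' where B': "B = (\<Inter>n::nat. B' n)" "\<And>n. \<exists>\<xi><\<alpha>. B' n \<in> G_star S \<xi>"
      using less.prems(2) unfolding G_star_odd[OF False] by blast
    have "A' n \<union> B' m \<in> G_star S \<alpha>" for n m
    proof -
      obtain \<xi> \<eta> where "\<xi> < \<alpha>" "A' n \<in> G_star S \<xi>" "\<eta> < \<alpha>" "B' m \<in> G_star S \<eta>"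
        using A'(2) B'(2) by metis
      then have "max \<xi> \<eta> < \<alpha>" "A' n \<in> G_star S (max \<xi> \<eta>)" "B' m \<in> G_star S (max \<xi> \<eta>)"
        by (auto intro: G_star_mono)
      then show ?thesis by (metis less.IH G_star_mono less_imp_le)
    qed
    then have "(\<Inter>n. \<Inter>m. A' n \<union> B' m) \<in> G_star S \<alpha>"
      by (intro G_star_countable_Inter False)
    moreover have "(\<Inter>n. \<Inter>m. A' n \<union> B' m) = A \<union> B"
      unfolding A'(1) B'(1) by blast
    ultimately show ?thesis by simp
  qed
qed

text \<open>A zero set of \<open>g\<close> is the intersection of the co-zero sets where
  \<open>g\<close> is below 1/(n+1), and odd ranks admit countable intersections.\<close>

lemma zero_set_in_G_star_odd:
  assumes "odd_ord \<alpha>" "zero_set_in S A"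
  shows "A \<in> G_star S \<alpha>"
proof -
  obtain g where g: "continuous_map S euclideanreal g" "g \<in> topspace S \<rightarrow> {0..1}"
    "A = {x \<in> topspace S. g x = 0}"
    using assms(2) unfolding zero_set_in_def by (auto simp: continuous_map_in_subtopology)
  have "x \<in> A" if x: "\<And>n::nat. x \<in> {x \<in> topspace S. 0 < 1 / real (Suc n) - g x}" for x
  proof -
    have "\<not> 0 < g x"
    proof
      assume "0 < g x"
      then obtain n where "1 / real (Suc n) < g x" by (rule nat_approx_posE)
      with x[of n] show False by simp
    qed
    moreover have "x \<in> topspace S" using x[of 0] by simp
    ultimately show ?thesis using g(2,3) by force
  qed
  moreover have "x \<in> {x \<in> topspace S. 0 < 1 / real (Suc n) - g x}" if "x \<in> A" for x n
    using that g(3) by simp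
  ultimately have "A = (\<Inter>n. {x \<in> topspace S. 0 < 1 / real (Suc n) - g x})" by blast
  moreover have "{x \<in> topspace S. 0 < 1 / real (Suc n) - g x} \<in> G_star S 0" for n
    unfolding G_star_zero by (intro cozero_set_inI continuous_intros g)
  ultimately show ?thesis
    unfolding G_star_odd[OF assms(1)] using odd_ord_pos[OF assms(1)] by (intro exI conjI allI)
qed

section \<open>The additive classes\<close>

lemma functionally_additive_odd:
  "odd_ord \<alpha> \<Longrightarrow> A \<in> functionally_additive \<alpha> S \<longleftrightarrow> A \<subseteq> topspace S \<and> topspace S - A \<in> G_star S \<alpha>"
  unfolding functionally_additive_def
  using F_star_iff_G_star_Diff[of A S \<alpha>] F_star_subset[of A S \<alpha>] by auto

lemma functionally_additive_even:
  "even_ord \<alpha> \<Longrightarrow> A \<in> functionally_additive \<alpha> S \<longleftrightarrow> A \<in> G_star S \<alpha>"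
  by (simp add: functionally_additive_def)

text \<open>At odd rank complementation turns the union into an intersection, under which
  \<open>G_star\<close> is closed at that parity.\<close>

lemma functionally_additive_countable_Union:
  assumes "\<And>n::nat. A n \<in> functionally_additive \<alpha> S"
  shows "(\<Union>n. A n) \<in> functionally_additive \<alpha> S"
proof (cases "even_ord \<alpha>")
  case True
  then show ?thesis
    using assms by (simp add: functionally_additive_even G_star_countable_Union)
next
  case False
  then have A: "A n \<subseteq> topspace S" "topspace S - A n \<in> G_star S \<alpha>" for n
    using assms by (simp_all add: functionally_additive_odd)
  have "topspace S - (\<Union>n. A n) = (\<Inter>n. topspace S - A n)" by blast
  then have "topspace S - (\<Union>n. A n) \<in> G_star S \<alpha>"
    using G_star_countable_Inter[OF False A(2)] by simp
  then show ?thesis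
    using A(1) False by (auto simp: functionally_additive_odd)
qed

lemma functionally_additive_empty: "{} \<in> functionally_additive \<alpha> S"
  by (cases "even_ord \<alpha>")
    (simp_all add: functionally_additive_even functionally_additive_odd G_star_empty G_star_topspace)

lemma functionally_additive_UN_countable:
  assumes "countable J" "\<And>i. i \<in> J \<Longrightarrow> A i \<in> functionally_additive \<alpha> S"
  shows "(\<Union>i\<in>J. A i) \<in> functionally_additive \<alpha> S"
proof (cases "J = {}")
  case False
  then have "(\<Union>i\<in>J. A i) = (\<Union>n. A (from_nat_into J n))"
    using assms(1) by (metis image_image range_from_nat_into)
  then show ?thesis
    using functionally_additive_countable_Union[of "\<lambda>n. A (from_nat_into J n)"] assms(2)
      from_nat_into[OF False] by simp
qed (simp add: functionally_additive_empty)

lemma functionally_additive_osuc_UN_Diff: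
  assumes "\<And>n::nat. A n \<in> functionally_additive \<alpha> S"
  shows "(\<Union>n. topspace S - A n) \<in> functionally_additive (osuc \<alpha>) S"
proof (cases "even_ord \<alpha>")
  case True
  have "A 0 \<subseteq> topspace S"
    using assms[of 0] True G_star_subset by (simp add: functionally_additive_even)
  then have "topspace S - (\<Union>n. topspace S - A n) = (\<Inter>n. A n)" by blast
  moreover have "(\<Inter>n. A n) \<in> G_star S (osuc \<alpha>)"
    using assms True less_osuc[of \<alpha>] G_star_odd[of "osuc \<alpha>"]
    by (metis even_ord_osuc functionally_additive_even)
  ultimately show ?thesis
    using True by (auto simp: functionally_additive_odd even_ord_osuc)
next
  case False
  then have "even_ord (osuc \<alpha>)" by (simp add: even_ord_osuc)
  moreover have "topspace S - A n \<in> G_star S (osuc \<alpha>)" for n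
    using assms[of n] False less_osuc[of \<alpha>] G_star_mono[of _ S \<alpha> "osuc \<alpha>"]
    by (simp add: functionally_additive_odd)
  ultimately have "(\<Union>n. topspace S - A n) \<in> G_star S (osuc \<alpha>)"
    by (intro G_star_countable_Union)
  with \<open>even_ord (osuc \<alpha>)\<close> show ?thesis by (simp only: functionally_additive_even)
qed

text \<open>Since \<open>{..<\<alpha>}\<close> is countable, the ranks of the \<open>n\<close>-th approximating sets can be made
  independent of the index \<open>i\<close>, at the price of inserting copies of a padding set \<open>P\<close>.\<close>

lemma G_star_uniform_ranks:
  fixes B :: "'i \<Rightarrow> nat \<Rightarrow> 'a set"
  assumes "\<alpha> \<noteq> 0" "\<forall>i\<in>I. \<forall>n. \<exists>\<xi><\<alpha>. B i n \<in> G_star S \<xi>" "\<And>\<xi>. P \<in> G_star S \<xi>"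
  shows "\<exists>(\<xi> :: nat \<Rightarrow> omega1) C. (\<forall>p. \<xi> p < \<alpha>) \<and> (\<forall>i\<in>I. \<forall>p. C i p \<in> G_star S (\<xi> p)) \<and>
    (\<forall>i\<in>I. insert P (range (C i)) = insert P (range (B i)))"
proof -
  define e where "e = from_nat_into {..<\<alpha>}"
  have "{..<\<alpha>} \<noteq> {}" using omega1_pos[OF assms(1)] by blast
  then have e: "range e = {..<\<alpha>}"
    unfolding e_def by (rule range_from_nat_into[OF _ countable_lessThan_omega1])
  \<comment> \<open>The code \<open>p\<close> carries a position \<open>n\<close> and a guess
    \<open>k\<close> of the rank. A right guess keeps the set, a wrong one substitutes the padding;
    every set is kept for some guess.\<close>
  define C where "C i p = (let (n, k) = prod_decode p in if B i n \<in> G_star S (e k) then B i n else P)"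
    for i p
  show ?thesis
  proof (intro exI[of _ "\<lambda>p. e (snd (prod_decode p))"] exI[of _ C] conjI allI ballI)
    show "e (snd (prod_decode p)) < \<alpha>" for p using e by blast
    show "C i p \<in> G_star S (e (snd (prod_decode p)))" if "i \<in> I" for i p
      using assms(3) by (auto simp: C_def Let_def split: prod.split)
    show "insert P (range (C i)) = insert P (range (B i))" if i: "i \<in> I" for i
    proof -
      have "C i p \<in> insert P (range (B i))" for p
        by (auto simp: C_def Let_def split: prod.split)
      moreover have "B i n \<in> range (C i)" for n
      proof -
        obtain \<xi> where "\<xi> < \<alpha>" "B i n \<in> G_star S \<xi>" using assms(2) i by blast
        moreover obtain k where "\<xi> = e k" using \<open>\<xi> < \<alpha>\<close> e by blast
        ultimately have "C i (prod_encode (n, k)) = B i n" by (simp add: C_def)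
        then show ?thesis by (metis rangeI)
      qed
      ultimately show ?thesis by blast
    qed
  qed
qed

section \<open>Locally finite unions of rectangles\<close>

text \<open>Disjointness is what lets the union over \<open>K\<close> commute with countable intersections.\<close>

lemma G_star_UN_disjoint_Times:
  fixes W :: "'i \<Rightarrow> 'a set" and B :: "'i \<Rightarrow> 'b set"
  assumes cz: "\<And>J. J \<in> K \<Longrightarrow> cozero_set_in X (W J)" and lf: "locally_finite_family X K W"
    and disj: "disjoint_family_on W K"
  shows "(\<And>J. J \<in> K \<Longrightarrow> B J \<in> G_star Y \<alpha>) \<Longrightarrow> (\<Union>J\<in>K. W J \<times> B J) \<in> G_star (prod_topology X Y) \<alpha>"
proof (induction \<alpha> arbitrary: B rule: less_induct)
  case (less \<alpha>)
  consider "\<alpha> = 0" | "odd_ord \<alpha>" | "even_ord \<alpha>" "\<alpha> \<noteq> 0" by blast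
  then show ?case
  proof cases
    case 1
    then show ?thesis using less.prems cz
      by (auto simp: G_star_zero intro!: cozero_set_in_Union_locally_finite
          cozero_set_in_Times locally_finite_family_Times[OF lf])
  next
    case 2
    then have "\<alpha> \<noteq> 0" using even_ord_zero by auto
    have "\<forall>J\<in>K. \<exists>A. B J = (\<Inter>n::nat. A n) \<and> (\<forall>n. \<exists>\<xi><\<alpha>. A n \<in> G_star Y \<xi>)"
      using less.prems unfolding G_star_odd[OF 2] by blast
    then obtain A where A: "\<And>J. J \<in> K \<Longrightarrow> B J = (\<Inter>n::nat. A J n)"
      "\<forall>J\<in>K. \<forall>n. \<exists>\<xi><\<alpha>. A J n \<in> G_star Y \<xi>"
      by metis
    obtain \<xi> :: "nat \<Rightarrow> omega1" and C where C: "\<forall>p. \<xi> p < \<alpha>" "\<forall>J\<in>K. \<forall>p. C J p \<in> G_star Y (\<xi> p)"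
      "\<forall>J\<in>K. insert (topspace Y) (range (C J)) = insert (topspace Y) (range (A J))"
      using G_star_uniform_ranks[of \<alpha> K A, OF \<open>\<alpha> \<noteq> 0\<close> A(2) G_star_topspace] by blast
    have B: "B J = (\<Inter>p. C J p)" if "J \<in> K" for J
    proof -
      \<comment> \<open>Both intersections lie in \<open>topspace Y\<close>, so the padding with
        that set does not alter them.\<close>
      have "A J 0 \<subseteq> topspace Y" "C J 0 \<subseteq> topspace Y"
        using A(2) C(2) that G_star_subset by metis+
      then have "\<Inter>(range (A J)) \<subseteq> topspace Y" "\<Inter>(range (C J)) \<subseteq> topspace Y"
        by (meson INF_lower2 UNIV_I)+
      then show ?thesis
        using A(1)[OF that] arg_cong[OF bspec[OF C(3) that], of Inter] by (simp add: Int_absorb1)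
    qed
    have "(\<Union>J\<in>K. W J \<times> B J) = (\<Inter>p. \<Union>J\<in>K. W J \<times> C J p)"
    proof (intro equalityI subsetI)
      fix z assume z: "z \<in> (\<Inter>p. \<Union>J\<in>K. W J \<times> C J p)"
      then have "\<forall>p. \<exists>J\<in>K. fst z \<in> W J \<and> snd z \<in> C J p"
        by (simp add: mem_Times_iff)
      then obtain j where j: "\<And>p. j p \<in> K" "\<And>p. fst z \<in> W (j p)" "\<And>p. snd z \<in> C (j p) p"
        by metis
      \<comment> \<open>The index could a priori vary with \<open>p\<close>, but disjointness allows
        only one \<open>W J\<close> over \<open>fst z\<close>.\<close>
      have "j p = j 0" for p
        using disj j(1,2) by (metis disjoint_family_on_def disjoint_iff)
      then have "snd z \<in> C (j 0) p" for p using j(3) by metis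
      then have "snd z \<in> B (j 0)" using B[OF j(1)] by simp
      then show "z \<in> (\<Union>J\<in>K. W J \<times> B J)" using j(1,2) by (auto simp: mem_Times_iff)
    qed (auto simp: B)
    moreover have "\<exists>\<eta><\<alpha>. (\<Union>J\<in>K. W J \<times> C J p) \<in> G_star (prod_topology X Y) \<eta>" for p
      using C(1,2) by (intro exI[of _ "\<xi> p"] conjI less.IH) auto
    ultimately show ?thesis unfolding G_star_odd[OF 2]
      by (intro exI[of _ "\<lambda>p. \<Union>J\<in>K. W J \<times> C J p"] conjI allI)
  next
    case 3
    have "\<forall>J\<in>K. \<exists>A. B J = (\<Union>n::nat. A n) \<and> (\<forall>n. \<exists>\<xi><\<alpha>. A n \<in> G_star Y \<xi>)"
      using less.prems unfolding G_star_even[OF 3] by blast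
    then obtain A where A: "\<And>J. J \<in> K \<Longrightarrow> B J = (\<Union>n::nat. A J n)"
      "\<forall>J\<in>K. \<forall>n. \<exists>\<xi><\<alpha>. A J n \<in> G_star Y \<xi>"
      by metis
    obtain \<xi> :: "nat \<Rightarrow> omega1" and C where C: "\<forall>p. \<xi> p < \<alpha>" "\<forall>J\<in>K. \<forall>p. C J p \<in> G_star Y (\<xi> p)"
      "\<forall>J\<in>K. insert {} (range (C J)) = insert {} (range (A J))"
      using G_star_uniform_ranks[of \<alpha> K A, OF 3(2) A(2) G_star_empty]
      by (elim exE conjE) (rule that; assumption)
    \<comment> \<open>Padding with the empty set does not alter unions.\<close>
    have B: "B J = (\<Union>p. C J p)" if "J \<in> K" for J
      using A(1)[OF that] arg_cong[OF bspec[OF C(3) that], of Union] by simp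
    have "(\<Union>J\<in>K. W J \<times> B J) = (\<Union>p. \<Union>J\<in>K. W J \<times> C J p)" by (auto simp: B)
    moreover have "\<exists>\<eta><\<alpha>. (\<Union>J\<in>K. W J \<times> C J p) \<in> G_star (prod_topology X Y) \<eta>" for p
      using C(1,2) by (intro exI[of _ "\<xi> p"] conjI less.IH) auto
    ultimately show ?thesis unfolding G_star_even[OF 3]
      by (intro exI[of _ "\<lambda>p. \<Union>J\<in>K. W J \<times> C J p"] conjI allI)
  qed
qed

text \<open>Even rank is \<open>G_star_UN_disjoint_Times\<close>. At odd rank the complement of the
  union splits into a zero set, off the strips over the \<open>W J\<close>, and the rectangles with
  complementary second sides; both parts lie in \<open>G_star\<close>.\<close>

lemma functionally_additive_UN_disjoint_Times:
  fixes W :: "'i \<Rightarrow> 'a set" and B :: "'i \<Rightarrow> 'b set"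
  assumes cz: "\<And>J. J \<in> K \<Longrightarrow> cozero_set_in X (W J)" and lf: "locally_finite_family X K W"
    and disj: "disjoint_family_on W K"
    and B: "\<And>J. J \<in> K \<Longrightarrow> B J \<in> functionally_additive \<alpha> Y"
  shows "(\<Union>J\<in>K. W J \<times> B J) \<in> functionally_additive \<alpha> (prod_topology X Y)"
proof (cases "even_ord \<alpha>")
  case True
  then show ?thesis
    using G_star_UN_disjoint_Times[OF cz lf disj, of B Y \<alpha>] B
    by (simp add: functionally_additive_even)
next
  case False
  let ?S = "prod_topology X Y" and ?W = "\<Union>J\<in>K. W J"
  have BY: "B J \<subseteq> topspace Y" "topspace Y - B J \<in> G_star Y \<alpha>" if "J \<in> K" for J
    using B[OF that] False by (simp_all add: functionally_additive_odd)
  have WX: "W J \<subseteq> topspace X" if "J \<in> K" for J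
    using cz[OF that] by (rule cozero_set_in_subset)
  have "topspace ?S - (\<Union>J\<in>K. W J \<times> B J) =
      (topspace ?S - ?W \<times> topspace Y) \<union> (\<Union>J\<in>K. W J \<times> (topspace Y - B J))"
  proof (intro equalityI subsetI)
    fix z assume "z \<in> (topspace ?S - ?W \<times> topspace Y) \<union> (\<Union>J\<in>K. W J \<times> (topspace Y - B J))"
    then show "z \<in> topspace ?S - (\<Union>J\<in>K. W J \<times> B J)"
    proof
      assume "z \<in> topspace ?S - ?W \<times> topspace Y"
      then show ?thesis using BY(1) by blast
    next
      assume "z \<in> (\<Union>J\<in>K. W J \<times> (topspace Y - B J))"
      then obtain J where J: "J \<in> K" "fst z \<in> W J" "snd z \<in> topspace Y - B J"
        by (auto simp: mem_Times_iff)
      \<comment> \<open>By disjointness the only rectangle that could contain a point over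
        \<open>W J\<close> is the one indexed by \<open>J\<close>.\<close>
      then have "snd z \<notin> B J'" if "J' \<in> K" "fst z \<in> W J'" for J'
        using disj that by (metis DiffD2 disjoint_family_on_def disjoint_iff)
      moreover have "fst z \<in> topspace X" using WX J(1,2) by blast
      ultimately show ?thesis using J(3) by (auto simp: mem_Times_iff)
    qed
  qed auto
  moreover have "zero_set_in ?S (topspace ?S - ?W \<times> topspace Y)"
    by (intro zero_set_in_Diff_cozero cozero_set_in_Times cozero_set_in_topspace
        cozero_set_in_Union_locally_finite cz lf)
  ultimately have "topspace ?S - (\<Union>J\<in>K. W J \<times> B J) \<in> G_star ?S \<alpha>"
    using G_star_Un[OF zero_set_in_G_star_odd[OF False]
        G_star_UN_disjoint_Times[OF cz lf disj BY(2)]] by simp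
  moreover have "(\<Union>J\<in>K. W J \<times> B J) \<subseteq> topspace ?S" using BY(1) WX by auto
  ultimately show ?thesis using False by (simp add: functionally_additive_odd)
qed

text \<open>For \<open>u i\<close> defining \<open>U i\<close>, the sets \<open>W J\<close> on which every \<open>u i\<close> with \<open>i \<in> J\<close> exceeds all
  \<open>u j\<close> with \<open>j \<in> I - J\<close> refine \<open>U\<close>, and they are disjoint for distinct \<open>J\<close> of the same
  cardinality.\<close>

lemma functionally_additive_UN_locally_finite_Times:
  fixes U :: "'i \<Rightarrow> 'a set" and B :: "'i \<Rightarrow> 'b set"
  assumes cz: "\<And>i. i \<in> I \<Longrightarrow> cozero_set_in X (U i)" and lf: "locally_finite_family X I U"
    and B: "\<And>i. i \<in> I \<Longrightarrow> B i \<in> functionally_additive \<alpha> Y"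
  shows "(\<Union>i\<in>I. U i \<times> B i) \<in> functionally_additive \<alpha> (prod_topology X Y)"
proof -
  obtain u :: "'i \<Rightarrow> 'a \<Rightarrow> real" where
    u: "\<And>i. i \<in> I \<Longrightarrow> continuous_map X euclideanreal (u i)"
    "\<And>i x. i \<in> I \<Longrightarrow> x \<in> topspace X \<Longrightarrow> 0 \<le> u i x \<and> u i x \<le> 1"
    "\<And>i. i \<in> I \<Longrightarrow> U i = {x \<in> topspace X. 0 < u i x}"
    using cozero_set_in_family[of I _ U, OF cz] by metis
  define s where "s J x = Sup (insert 0 ((\<lambda>j. u j x) ` (I - J)))" for J x
  define W where "W J = {x \<in> topspace X. \<forall>i\<in>J. s J x < u i x}" for J
  \<comment> \<open>Sorting by cardinality produces the countably many disjoint families.\<close>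
  define K where "K k = {J. J \<subseteq> I \<and> finite J \<and> J \<noteq> {} \<and> card J = k}" for k
  have s_ge: "0 \<le> s J x" "\<And>j. j \<in> I - J \<Longrightarrow> u j x \<le> s J x" if "x \<in> topspace X" for J x
    unfolding s_def using u(2) that
    by (auto intro!: Sup_insert_zero_upper(1) Sup_insert_zero_upper(2)[of "I - J" "\<lambda>j. u j x"])
  have W_U: "W J \<subseteq> U i" if "J \<subseteq> I" "i \<in> J" for J i
    using that s_ge(1) u(3) unfolding W_def by (force intro: le_less_trans)
  have s_cont: "continuous_map X euclideanreal (s J)" for J
    unfolding s_def
  proof (rule continuous_map_Sup_locally_small)
    fix x and \<epsilon> :: real assume x: "x \<in> topspace X" and "0 < \<epsilon>"
    obtain N where N: "openin X N" "x \<in> N" "finite {i \<in> I. U i \<inter> N \<noteq> {}}"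
      using locally_finite_familyE[OF lf x] .
    have "{i \<in> I - J. \<exists>z\<in>N. \<epsilon> < u i z} \<subseteq> {i \<in> I. U i \<inter> N \<noteq> {}}"
      using u(3) \<open>0 < \<epsilon>\<close> openin_subset[OF N(1)] by force
    with N show "\<exists>N. openin X N \<and> x \<in> N \<and> finite {i \<in> I - J. \<exists>z\<in>N. \<epsilon> < u i z}"
      using finite_subset by blast
  qed (use u in auto)
  have W_cozero: "cozero_set_in X (W J)" if "J \<subseteq> I" "finite J" for J
  proof -
    \<comment> \<open>A finite product of positive parts is positive exactly when all differences
      are, giving one continuous function for \<open>W J\<close>.\<close>
    have "0 < (\<Prod>i\<in>J. max 0 (u i x - s J x)) \<longleftrightarrow> (\<forall>i\<in>J. s J x < u i x)" for x
    proof
      assume "0 < (\<Prod>i\<in>J. max 0 (u i x - s J x))"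
      then have "(\<Prod>i\<in>J. max 0 (u i x - s J x)) \<noteq> 0" by simp
      then have "\<forall>i\<in>J. max 0 (u i x - s J x) \<noteq> 0" using that(2) by (simp add: prod_zero_iff)
      then show "\<forall>i\<in>J. s J x < u i x" by (auto simp: max_def split: if_splits)
    qed (auto intro: prod_pos)
    then have "W J = {x \<in> topspace X. 0 < (\<Prod>i\<in>J. max 0 (u i x - s J x))}"
      by (simp add: W_def)
    then show ?thesis
      using that u(1) s_cont by (auto intro!: cozero_set_inI continuous_intros)
  qed
  have W_lf: "locally_finite_family X (K k) W" for k
    unfolding locally_finite_family_def
  proof
    fix x assume x: "x \<in> topspace X"
    obtain N where N: "openin X N" "x \<in> N" "finite {i \<in> I. U i \<inter> N \<noteq> {}}"
      using locally_finite_familyE[OF lf x] .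
    \<comment> \<open>If \<open>W J\<close> meets \<open>N\<close>, so does \<open>U i\<close> for
      each \<open>i\<close> in \<open>J\<close>; hence \<open>J\<close> is a subset of a fixed
      finite set.\<close>
    have "{J \<in> K k. W J \<inter> N \<noteq> {}} \<subseteq> Pow {i \<in> I. U i \<inter> N \<noteq> {}}"
      unfolding K_def using W_U by blast
    then have "finite {J \<in> K k. W J \<inter> N \<noteq> {}}"
      using N(3) by (meson finite_Pow_iff finite_subset)
    with N show "\<exists>N. openin X N \<and> x \<in> N \<and> finite {J \<in> K k. W J \<inter> N \<noteq> {}}"
      by blast
  qed
  have W_disj: "disjoint_family_on W (K k)" for k
    unfolding disjoint_family_on_def
  proof (intro ballI impI)
    fix J J' assume J: "J \<in> K k" "J' \<in> K k" "J \<noteq> J'"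
    \<comment> \<open>Distinct finite sets of equal size are incomparable. An \<open>i\<close> only
      in \<open>J\<close> and a \<open>j\<close> only in \<open>J'\<close> would then each have the
      strictly larger function at a common point.\<close>
    have "\<not> J \<subseteq> J'" "\<not> J' \<subseteq> J"
      using J card_subset_eq[of J' J] card_subset_eq[of J J'] unfolding K_def by auto
    then obtain i j where ij: "i \<in> J" "i \<notin> J'" "j \<in> J'" "j \<notin> J" by blast
    then have I: "i \<in> I" "j \<in> I" using J unfolding K_def by blast+
    have False if "x \<in> W J" "x \<in> W J'" for x
    proof -
      have "x \<in> topspace X" "s J x < u i x" "s J' x < u j x"
        using that ij unfolding W_def by auto
      moreover have "u j x \<le> s J x" "u i x \<le> s J' x"
        using s_ge(2) \<open>x \<in> topspace X\<close> ij I by auto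
      ultimately show False by linarith
    qed
    then show "W J \<inter> W J' = {}" by blast
  qed
  have cover: "\<exists>J. J \<subseteq> I \<and> finite J \<and> i \<in> J \<and> x \<in> W J" if i: "i \<in> I" and xU: "x \<in> U i" for i x
  proof -
    have x: "x \<in> topspace X" and pos: "0 < u i x" using u(3)[OF i] xU by auto
    obtain N where N: "openin X N" "x \<in> N" "finite {j \<in> I. U j \<inter> N \<noteq> {}}"
      using locally_finite_familyE[OF lf x] .
    have "{j \<in> I. 0 < u j x} \<subseteq> {j \<in> I. U j \<inter> N \<noteq> {}}"
      using N(2) x u(3) by blast
    then have fin: "finite {j \<in> I. 0 < u j x}" using N(3) finite_subset by blast
    \<comment> \<open>The cut is made at the level \<open>u i x\<close>: this level is positive, so
      \<open>J\<close> is finite by local finiteness, and it contains \<open>i\<close>.\<close>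
    define J where "J = {j \<in> I. u i x \<le> u j x}"
    have "J \<subseteq> {j \<in> I. 0 < u j x}" using pos unfolding J_def by auto
    then have "finite J" using fin finite_subset by blast
    \<comment> \<open>Outside \<open>J\<close> only finitely many values occur at \<open>x\<close>,
      so the supremum is attained and stays strictly below \<open>u i x\<close>.\<close>
    have "(\<lambda>j. u j x) ` (I - J) \<subseteq> insert 0 ((\<lambda>j. u j x) ` {j \<in> I. 0 < u j x})"
      using u(2)[OF _ x] by (force simp: order.order_iff_strict)
    then have "finite (insert 0 ((\<lambda>j. u j x) ` (I - J)))"
      using fin finite_subset by (metis finite.insertI finite_imageI)
    then have "s J x < u i x"
      unfolding s_def by (rule finite_imp_Sup_less[OF _ insertI1]) (auto simp: J_def pos)
    moreover have "u i x \<le> u k x" if "k \<in> J" for k using that by (simp add: J_def)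
    ultimately have "x \<in> W J" using x unfolding W_def by (auto intro: less_le_trans)
    moreover have "J \<subseteq> I" "i \<in> J" using i by (auto simp: J_def)
    ultimately show ?thesis using \<open>finite J\<close> by blast
  qed
  \<comment> \<open>As \<open>W J\<close> lies in every \<open>U i\<close> with \<open>i\<close> in
    \<open>J\<close>, all second sides belonging to \<open>J\<close> can be merged over it.\<close>
  have "(\<Union>i\<in>I. U i \<times> B i) = (\<Union>k. \<Union>J\<in>K k. W J \<times> (\<Union>i\<in>J. B i))"
  proof (intro equalityI subsetI)
    fix z assume "z \<in> (\<Union>i\<in>I. U i \<times> B i)"
    then obtain i where i: "i \<in> I" "fst z \<in> U i" "snd z \<in> B i" by auto
    then obtain J where J: "J \<subseteq> I" "finite J" "i \<in> J" "fst z \<in> W J" using cover by metis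
    then have "J \<in> K (card J)" unfolding K_def by auto
    then show "z \<in> (\<Union>k. \<Union>J\<in>K k. W J \<times> (\<Union>i\<in>J. B i))"
      using J(3,4) i(3) by (intro UN_I[of "card J"] UN_I[of J]) (auto simp: mem_Times_iff)
  next
    fix z assume "z \<in> (\<Union>k. \<Union>J\<in>K k. W J \<times> (\<Union>i\<in>J. B i))"
    then obtain J i where J: "J \<subseteq> I" "i \<in> J" "fst z \<in> W J" "snd z \<in> B i"
      unfolding K_def by auto
    then have "fst z \<in> U i" using W_U by blast
    with J show "z \<in> (\<Union>i\<in>I. U i \<times> B i)" by (auto simp: mem_Times_iff)
  qed
  moreover have "(\<Union>J\<in>K k. W J \<times> (\<Union>i\<in>J. B i)) \<in> functionally_additive \<alpha> (prod_topology X Y)" for k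
  proof (rule functionally_additive_UN_disjoint_Times[OF _ W_lf W_disj])
    fix J assume J: "J \<in> K k"
    then show "cozero_set_in X (W J)" unfolding K_def by (auto intro: W_cozero)
    show "(\<Union>i\<in>J. B i) \<in> functionally_additive \<alpha> Y"
      using J B unfolding K_def
      by (intro functionally_additive_UN_countable countable_finite) auto
  qed
  ultimately show ?thesis by (simp add: functionally_additive_countable_Union)
qed

section \<open>Maps continuous in the first variable\<close>

text \<open>The complement of \<open>V\<close> is a G-delta, so \<open>V\<close> is a countable
  union of closed sets; normality inserts between each of these and \<open>V\<close> an open set
  whose closure stays in \<open>V\<close>.\<close>

lemma perfectly_normal_space_open_exhaustion:
  assumes "perfectly_normal_space Z" "openin Z V"
  obtains Q :: "nat \<Rightarrow> 'a set" where "\<And>m. openin Z (Q m)" "\<And>m. Z closure_of Q m \<subseteq> V"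
    "V = (\<Union>m. Q m)"
proof -
  have "gdelta_in Z (topspace Z - V)"
    using assms unfolding perfectly_normal_space_def by blast
  then have "fsigma_in Z V"
    using openin_subset[OF assms(2)] by (simp add: fsigma_in_gdelta_in)
  then obtain C where C: "\<And>m::nat. closedin Z (C m)" "\<Union>(range C) = V"
    by (auto simp: fsigma_in_ascending)
  have "normal_space Z"
    using assms(1) unfolding perfectly_normal_space_def by blast
  moreover have "C m \<subseteq> V" for m
    using C(2) by blast
  ultimately have "\<exists>T. openin Z T \<and> C m \<subseteq> T \<and> Z closure_of T \<subseteq> V" for m
    using C(1) assms(2) unfolding normal_space_alt by meson
  then obtain Q where Q: "\<And>m. openin Z (Q m)" "\<And>m. C m \<subseteq> Q m" "\<And>m. Z closure_of Q m \<subseteq> V"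
    by metis
  have "Q m \<subseteq> V" for m
    using Q(1,3) closure_of_subset openin_subset by (metis subset_trans)
  then have "V = (\<Union>m. Q m)" using Q(2) C(2) by blast
  with Q show thesis using that by blast
qed

theorem theorem4p1:
  fixes X :: "'a topology" and Y :: "'b topology" and Z :: "'c topology" and \<alpha> :: omega1
  assumes "strong_PP_space X"
    and "perfectly_normal_space Z"
  shows "CH_bar \<alpha> X Y Z \<subseteq> H_star (osuc \<alpha>) (prod_topology X Y) Z"
proof
  fix f assume f: "f \<in> CH_bar \<alpha> X Y Z"
  let ?S = "prod_topology X Y"
  define D where "D = {x \<in> topspace X. (\<lambda>y. f (x, y)) \<in> H_star \<alpha> Y Z}"
  have f_into: "f \<in> topspace ?S \<rightarrow> topspace Z"
    and f_cont: "\<And>y. y \<in> topspace Y \<Longrightarrow> continuous_map X Z (\<lambda>x. f (x, y))"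
    and "dense_in X D"
    using f unfolding CH_bar_def D_def by auto
  then obtain I :: "nat \<Rightarrow> ('a set \<times> 'a) set" and U p where "PP_families X D I U p"
    using assms(1) unfolding strong_PP_space_def by blast
  then have cover: "\<And>n. (\<Union>i\<in>I n. U n i) = topspace X"
    and lf: "\<And>n. locally_finite_family X (I n) (U n)"
    and cz: "\<And>n i. i \<in> I n \<Longrightarrow> cozero_set_in X (U n i)"
    and pD: "\<And>n i. i \<in> I n \<Longrightarrow> p n i \<in> D"
    and lim: "\<And>x j. x \<in> topspace X \<Longrightarrow> (\<And>n. j n \<in> I n \<and> x \<in> U n (j n)) \<Longrightarrow>
        limitin X (\<lambda>n. p n (j n)) x sequentially"
    unfolding PP_families_def locally_finite_cover_def locally_finite_family_def by blast+
  \<comment> \<open>Continuity in the first variable carries the convergence of the selected points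
    to the values of \<open>f\<close>.\<close>
  have limf: "limitin Z (\<lambda>n. f (p n (j n), y)) (f (x, y)) sequentially"
    if "x \<in> topspace X" "y \<in> topspace Y" "\<And>n. j n \<in> I n \<and> x \<in> U n (j n)" for x y j
    using continuous_map_limit[OF f_cont[OF that(2)] lim[OF that(1,3)]] by (simp add: o_def)
  show "f \<in> H_star (osuc \<alpha>) ?S Z"
    unfolding H_star_def
  proof (intro CollectI conjI allI impI f_into)
    fix V assume "openin Z V"
    then obtain Q :: "nat \<Rightarrow> 'c set" where Q: "\<And>m. openin Z (Q m)"
      "\<And>m. Z closure_of Q m \<subseteq> V" "V = (\<Union>m. Q m)"
      using perfectly_normal_space_open_exhaustion[OF assms(2)] by metis
    \<comment> \<open>\<open>R m\<close> is open, so membership of a section in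
      \<open>H_star\<close> applies to it. \<open>A m N\<close> holds the points for which, at some
      stage from \<open>N\<close> on, an admissible index gives a value off the closure of
      \<open>Q m\<close>.\<close>
    define R where "R m = topspace Z - Z closure_of Q m" for m
    define A where "A m N = (\<Union>n\<in>{N..}. \<Union>i\<in>I n. U n i \<times> {y \<in> topspace Y. f (p n i, y) \<in> R m})"
      for m N
    have "A m N \<in> functionally_additive \<alpha> ?S" for m N
      unfolding A_def
    proof (rule functionally_additive_UN_countable[OF countableI_type],
        rule functionally_additive_UN_locally_finite_Times[OF cz lf])
      fix n i assume "i \<in> I n"
      then have "(\<lambda>y. f (p n i, y)) \<in> H_star \<alpha> Y Z" using pD unfolding D_def by blast
      moreover have "openin Z (R m)" unfolding R_def
        by (rule openin_diff[OF openin_topspace closedin_closure_of])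
      ultimately show "{y \<in> topspace Y. f (p n i, y) \<in> R m} \<in> functionally_additive \<alpha> Y"
        unfolding H_star_def by blast
    qed
    then have "(\<Union>q. topspace ?S - case_prod A (prod_decode q)) \<in> functionally_additive (osuc \<alpha>) ?S"
      by (intro functionally_additive_osuc_UN_Diff) (simp split: prod.split)
    moreover have "(\<Union>q. topspace ?S - case_prod A (prod_decode q)) = (\<Union>m. \<Union>N. topspace ?S - A m N)"
      using UN_prod_decode[of "\<lambda>m N. topspace ?S - A m N"] by (simp add: case_prod_unfold)
    moreover have "{z \<in> topspace ?S. f z \<in> V} = (\<Union>m. \<Union>N. topspace ?S - A m N)"
    proof (intro equalityI subsetI)
      fix z assume "z \<in> {z \<in> topspace ?S. f z \<in> V}"
      then obtain x y m where z: "z = (x, y)" and x: "x \<in> topspace X" and y: "y \<in> topspace Y"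
        and m: "f (x, y) \<in> Q m"
        using Q(3) by auto
      text \<open>Choose a bad index whenever there is one.\<close>
      have "\<forall>n. \<exists>i. (i \<in> I n \<and> x \<in> U n i) \<and>
          ((\<exists>i'\<in>I n. x \<in> U n i' \<and> f (p n i', y) \<in> R m) \<longrightarrow> f (p n i, y) \<in> R m)"
        using cover x by blast
      then obtain j where j: "\<And>n. j n \<in> I n \<and> x \<in> U n (j n)"
        "\<And>n i. i \<in> I n \<Longrightarrow> x \<in> U n i \<Longrightarrow> f (p n i, y) \<in> R m \<Longrightarrow> f (p n (j n), y) \<in> R m"
        by metis
      \<comment> \<open>From \<open>N\<close> on the chosen values lie in \<open>Q m\<close>, hence
        off \<open>R m\<close>. Any bad index at such a stage would have made the chosen one
        bad.\<close>
      obtain N where N: "\<And>n. n \<ge> N \<Longrightarrow> f (p n (j n), y) \<in> Q m"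
        using limf[OF x y j(1)] Q(1) m
        unfolding limitin_def eventually_sequentially by blast
      have "f (p n i, y) \<notin> R m" if "n \<ge> N" "i \<in> I n" "x \<in> U n i" for n i
        using j(2)[OF that(2,3)] N[OF that(1)] closure_of_subset[OF openin_subset[OF Q(1)]]
        unfolding R_def by blast
      then have "z \<in> topspace ?S - A m N"
        using x y unfolding z A_def by auto
      then show "z \<in> (\<Union>m. \<Union>N. topspace ?S - A m N)" by blast
    next
      fix z assume "z \<in> (\<Union>m. \<Union>N. topspace ?S - A m N)"
      then obtain x y m N where z: "z = (x, y)" and x: "x \<in> topspace X" and y: "y \<in> topspace Y"
        and nA: "(x, y) \<notin> A m N"
        by auto
      \<comment> \<open>In this direction any admissible selection works: its values are in the
        closure of \<open>Q m\<close> from \<open>N\<close> on, so their limit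
        \<open>f (x, y)\<close> is in that closure and thus in \<open>V\<close>.\<close>
      have "\<forall>n. \<exists>i. i \<in> I n \<and> x \<in> U n i" using cover x by blast
      then obtain j where j: "\<And>n. j n \<in> I n \<and> x \<in> U n (j n)" by metis
      have "f (p n (j n), y) \<in> Z closure_of Q m" if "n \<ge> N" for n
      proof -
        have "p n (j n) \<in> topspace X" using pD j unfolding D_def by blast
        then have "f (p n (j n), y) \<in> topspace Z" using f_into y by auto
        moreover have "f (p n (j n), y) \<notin> R m" using nA j that y unfolding A_def by blast
        ultimately show ?thesis unfolding R_def by blast
      qed
      then have "f (x, y) \<in> Z closure_of Q m"
        using limitin_closedin[OF limf[OF x y j] closedin_closure_of]
        by (simp add: eventually_sequentially) blast
      then show "z \<in> {z \<in> topspace ?S. f z \<in> V}" using Q(2) x y z by auto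
    qed
    ultimately show "{z \<in> topspace ?S. f z \<in> V} \<in> functionally_additive (osuc \<alpha>) ?S"
      by simp
  qed
qed

end
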